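(* Suppose that no $q_j$ ($j\in\mathcal M$) is located on the boundary of $\mathcal V_i(p)$. When $\alpha_1:\mathbb R\to\mathbb R$ and $\alpha_2:\mathbb R\to\mathbb R$ are set as linear functions such that $\alpha_1(b_{i,I})=a_1 b_{i,I}$ and $\alpha_2(b_{i,\phi})=a_2 b_{i,\phi}$, where $a_1>0$ and $a_2>0$ are positive scalars, the problem $$(u_i^*,w_i^* )=\operatorname*{arg\,min}_{(u_i,w_i)\in\mathcal U\times\mathbb R}\ \epsilon\|u_i\|^2+|w_i|^2\quad\text{s.t.}\quad \dot b_{i,I}+\alpha_1(b_{i,I})\ge w_i,\qquad \dot b_{i,\phi}+\alpha_2(b_{i,\phi})\ge 0$$ is equivalently reformulated as $$(u_i^*,w_i^* )=\operatorname*{arg\,min}_{(u_i,w_i)\in\mathcal U\times\mathbb R}\ \epsilon\|u_i\|^2+|w_i|^2\quad\text{s.t.}\quad \xi_{1i}^{T}u_i+\xi_{2i}\ge w_i,\qquad \chi_{1i}^{T}u_i+\chi_{2i}\ge 0,$$ where $$\xi_{1i}:=\sum_{j\in\mathcal V_i(p)}\delta\,\frac{\partial h(p_i,q_j)}{\partial p_i}\,\psi_j,\qquad \xi_{2i}:=-\frac{a_1\gamma}{n}+\sum_{j\in\mathcal V_i(p)}\bigl(-\delta^2h^2(p_i,q_j)+a_1\,\delta\, h(p_i,q_j)\bigr)\psi_j,$$ $$\chi_{1i}:=\begin{bmatrix}0\\0\\0\\2\left(\phi_i-\frac{\phi_{\min}+\phi_{\max}}{2}\right)\end{bmatrix},\qquad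 \chi_{2i}:=a_2\left((\phi_{\max}-\phi_{\min})^2-\left(\phi_i-\frac{\phi_{\min}+\phi_{\max}}{2}\right)^2\right).$$
   Context: Drones: there are $n$ drones, indexed by $\mathcal I=\{1,\dots,n\}$. Drone $i$ has state $p_i=[x_i\ y_i\ \varphi_i\ \phi_i]^T\in\mathcal P\times[0,2\pi)\times[0,\pi/2]\subset\mathbb R^4$, where $\mathcal P\subset\mathbb R^2$ is compact; $(x_i,y_i)$ is the planar position, $\varphi_i$ and $\phi_i$ are the horizontal and vertical gimbal angles of the onboard camera, and the altitude is a constant $z_c$. Write $p=(p_i)_{i\in\mathcal I}$. The dynamics are $\dot p_i=u_i$, with input $u_i=[u_i^x\ u_i^y\ u_i^\varphi\ u_i^\phi]^T\in\mathcal U$, where $\mathcal U\subseteq\mathbb R^4$ is the input set. The body frame of drone $i$ is fixed on its camera, and its orientation relative to the world frame is $R_i\in SO(3)$. Points: $\mathcal M=\{1,\dots,m\}$. A 5D space $\mathcal Q_c\subset\mathbb R^5$ of observation variables (position coordinates $x,y,z$ and viewing angles $\theta_h\in[-\pi,\pi)$, $\theta_v\in(0,\pi/2]$) is discretized into $m$ cells, and $q_j=[x_j\ y_j\ z_j\ \theta^h_j\ \theta^v_j]\in\mathcal Q_c$ is a representative point of the $j$-th cell, $j\in\mathcal M$. Geometry: $\eta_i=[\cos\varphi_i\cos\phi_i,\ \sin\varphi_i\cos\phi_i,\ \sin\phi_i]^T$ is the optical axis of the camera in the body frame; $v^w_{ij}=[x_j-x_i,\ y_j-y_i,\ z_j-z_c]^T$,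 $v_{ij}=R_i^Tv^w_{ij}$, and $v_j=[\cos\theta^h_j\cos\theta^v_j,\ \sin\theta^h_j\cos\theta^v_j,\ \sin\theta^v_j]^T$. Performance function: with $\mathrm{fov}$ the half-angle of the camera's field of view and tuning parameters $\sigma_1,\sigma_2$, $$h_1(p_i,q_j)=\bigl(\mathrm{fov}-\arccos(\eta_i\cdot v_{ij}/\|v_{ij}\|)\bigr)^2,\qquad h_2(p_i,q_j)=\bigl(\arccos(v_j\cdot v^w_{ij}/\|v^w_{ij}\|)\bigr)^2,$$ $$h(p_i,q_j)=\exp\!\left(-\frac{h_1(p_i,q_j)}{2\sigma_1^2}\right)\exp\!\left(-\frac{h_2(p_i,q_j)}{2\sigma_2^2}\right).$$ The gradient $\partial h(p_i,q_j)/\partial p_i$ is a column vector in $\mathbb R^4$. Importance indices: $\psi_j\in[0,\infty)$ is assigned to $q_j$ and evolves by $\dot\psi_j=-\delta\max_{k\in\mathcal I}h(p_k,q_j)\,\psi_j$, with $\delta>0$. Voronoi-like partition of $\mathcal M$: $\mathcal V_i(p)=\{j\in\mathcal M\mid h(p_i,q_j)\ge h(p_k,q_j)\ \forall k\in\mathcal I\}$. That $q_j$ is on the boundary of $\mathcal V_i(p)$ means that $j\in\mathcal V_i(p)$ and $h(p_i,q_j)=h(p_k,q_j)$ for some $k\ne i$. Barrier-like functions: given $\gamma>0$, let $I_i=\sum_{j\in\mathcal V_i(p)}\delta\,h(p_i,q_j)\psi_j$ and $b_{i,I}=I_i-\gamma/n$. Given the lower and upper limits $\phi_{\min}$ and $\phi_{\max}$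 of the vertical gimbal angle, let $b_{i,\phi}=(\phi_{\max}-\phi_{\min})^2-\left(\phi_i-\frac{\phi_{\min}+\phi_{\max}}{2}\right)^2$. The dots denote time derivatives along the dynamics above: $\dot b_{i,I}=\sum_j\frac{\partial b_{i,I}}{\partial\psi_j}\dot\psi_j+\left(\frac{\partial b_{i,I}}{\partial p_i}\right)^Tu_i$ and $\dot b_{i,\phi}=\left(\frac{\partial b_{i,\phi}}{\partial p_i}\right)^Tu_i$. In the optimization problems, $\epsilon$ is the penalty weight and $w_i\in\mathbb R$ is a slack variable.
   Formalization: The last entry of χ_{1i} is corrected to −2(φ_i−(φ_min+φ_max)/2), the true gradient of b_{i,φ}; also made explicit: σ_1,σ_2≠0, v^w_{ij}≠0, h(·,q_j) differentiable at p_i for j∈V_i(p), and R_i continuous at p_i if it depends on the state. *)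

theory Defs
  imports "HOL-Analysis.Analysis"
begin

text \<open>
  A drone state is \<open>[x, y, \<phi>h, \<phi>v]\<close> (planar position, horizontal and vertical gimbal angle),
  an observation point is \<open>[x, y, z, \<theta>h, \<theta>v]\<close>; components are numbered from 1.
  Drones are indexed by \<open>{1..n}\<close> and observation points by \<open>{1..m}\<close>.
\<close>

type_synonym drone_state = "real ^ 4"
type_synonym obs_point = "real ^ 5"

definition optical_axis :: "drone_state \<Rightarrow> real ^ 3" where
  "optical_axis x = vector [cos (x $ 3) * cos (x $ 4), sin (x $ 3) * cos (x $ 4), sin (x $ 4)]"

definition view_world :: "real \<Rightarrow> drone_state \<Rightarrow> obs_point \<Rightarrow> real ^ 3" where
  "view_world zc x q = vector [q $ 1 - x $ 1, q $ 2 - x $ 2, q $ 3 - zc]"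

definition view_body :: "real ^ 3 ^ 3 \<Rightarrow> real \<Rightarrow> drone_state \<Rightarrow> obs_point \<Rightarrow> real ^ 3" where
  "view_body R zc x q = transpose R *v view_world zc x q"

definition view_angle_vec :: "obs_point \<Rightarrow> real ^ 3" where
  "view_angle_vec q = vector [cos (q $ 4) * cos (q $ 5), sin (q $ 4) * cos (q $ 5), sin (q $ 5)]"

definition h1 :: "real \<Rightarrow> real ^ 3 ^ 3 \<Rightarrow> real \<Rightarrow> drone_state \<Rightarrow> obs_point \<Rightarrow> real" where
  "h1 fov R zc x q =
     (fov - arccos (optical_axis x \<bullet> view_body R zc x q / norm (view_body R zc x q)))\<^sup>2"

definition h2 :: "real \<Rightarrow> drone_state \<Rightarrow> obs_point \<Rightarrow> real" where
  "h2 zc x q = (arccos (view_angle_vec q \<bullet> view_world zc x q / norm (view_world zc x q)))\<^sup>2"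

text \<open>
  The camera orientation is a function \<open>R\<close> of the state, because the body frame is attached to a
  gimballed camera; an orientation that does not depend on the state is the constant case.
\<close>

definition performance ::
  "real \<Rightarrow> real \<Rightarrow> real \<Rightarrow> real \<Rightarrow> (drone_state \<Rightarrow> real ^ 3 ^ 3) \<Rightarrow> drone_state \<Rightarrow> obs_point \<Rightarrow> real"
where
  "performance fov \<sigma>1 \<sigma>2 zc R x q =
     exp (- (h1 fov (R x) zc x q / (2 * \<sigma>1\<^sup>2))) * exp (- (h2 zc x q / (2 * \<sigma>2\<^sup>2)))"

definition gradient :: "('a :: real_inner \<Rightarrow> real) \<Rightarrow> 'a \<Rightarrow> 'a" where
  "gradient f x = (THE D. GDERIV f x :> D)"

text \<open>
  Below, \<open>h k x j\<close> is the performance of drone \<open>k\<close> in state \<open>x\<close> at the \<open>j\<close>-th observation point.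
\<close>

definition cells ::
  "(nat \<Rightarrow> drone_state \<Rightarrow> nat \<Rightarrow> real) \<Rightarrow> nat \<Rightarrow> nat \<Rightarrow> (nat \<Rightarrow> drone_state) \<Rightarrow> nat \<Rightarrow> nat set" where
  "cells h n m p i = {j \<in> {1..m}. \<forall>k \<in> {1..n}. h i (p i) j \<ge> h k (p k) j}"

definition on_cell_boundary ::
  "(nat \<Rightarrow> drone_state \<Rightarrow> nat \<Rightarrow> real) \<Rightarrow> nat \<Rightarrow> nat \<Rightarrow> (nat \<Rightarrow> drone_state) \<Rightarrow> nat \<Rightarrow> nat \<Rightarrow> bool" where
  "on_cell_boundary h n m p i j \<longleftrightarrow>
     j \<in> cells h n m p i \<and> (\<exists>k \<in> {1..n}. k \<noteq> i \<and> h i (p i) j = h k (p k) j)"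

definition psi_dot ::
  "(nat \<Rightarrow> drone_state \<Rightarrow> nat \<Rightarrow> real) \<Rightarrow> nat \<Rightarrow> real \<Rightarrow>
     (nat \<Rightarrow> drone_state) \<Rightarrow> (nat \<Rightarrow> real) \<Rightarrow> nat \<Rightarrow> real" where
  "psi_dot h n \<delta> p \<psi> j = - \<delta> * Max ((\<lambda>k. h k (p k) j) ` {1..n}) * \<psi> j"

definition b_info ::
  "(nat \<Rightarrow> drone_state \<Rightarrow> nat \<Rightarrow> real) \<Rightarrow> nat \<Rightarrow> nat \<Rightarrow> real \<Rightarrow> real \<Rightarrow>
     nat \<Rightarrow> (nat \<Rightarrow> drone_state) \<Rightarrow> (nat \<Rightarrow> real) \<Rightarrow> real" where
  "b_info h n m \<delta> \<gamma> i p \<psi> =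
     (\<Sum>j \<in> cells h n m p i. \<delta> * h i (p i) j * \<psi> j) - \<gamma> / real n"

definition b_gimbal :: "real \<Rightarrow> real \<Rightarrow> drone_state \<Rightarrow> real" where
  "b_gimbal \<phi>min \<phi>max x = (\<phi>max - \<phi>min)\<^sup>2 - (x $ 4 - (\<phi>min + \<phi>max) / 2)\<^sup>2"

text \<open>
  The derivatives of the barrier-like functions of drone \<open>i\<close> along the dynamics.  The gradient with
  respect to the state of drone \<open>i\<close> is that of the full function, including the dependence of
  the index set \<open>cells h n m p i\<close> on the state.
\<close>

definition b_info_dot ::
  "(nat \<Rightarrow> drone_state \<Rightarrow> nat \<Rightarrow> real) \<Rightarrow> nat \<Rightarrow> nat \<Rightarrow> real \<Rightarrow> real \<Rightarrow>
     nat \<Rightarrow> (nat \<Rightarrow> drone_state) \<Rightarrow> (nat \<Rightarrow> real) \<Rightarrow> real ^ 4 \<Rightarrow> real" where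
  "b_info_dot h n m \<delta> \<gamma> i p \<psi> u =
     (\<Sum>j \<in> {1..m}. deriv (\<lambda>s. b_info h n m \<delta> \<gamma> i p (\<psi>(j := s))) (\<psi> j) * psi_dot h n \<delta> p \<psi> j)
     + gradient (\<lambda>x. b_info h n m \<delta> \<gamma> i (p(i := x)) \<psi>) (p i) \<bullet> u"

definition b_gimbal_dot :: "real \<Rightarrow> real \<Rightarrow> drone_state \<Rightarrow> real ^ 4 \<Rightarrow> real" where
  "b_gimbal_dot \<phi>min \<phi>max x u = gradient (b_gimbal \<phi>min \<phi>max) x \<bullet> u"

definition cost :: "real \<Rightarrow> (real ^ 4) \<times> real \<Rightarrow> real" where
  "cost \<epsilon> = (\<lambda>(u, w). \<epsilon> * (norm u)\<^sup>2 + \<bar>w\<bar>\<^sup>2)"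

definition argmin_set :: "('a \<Rightarrow> real) \<Rightarrow> 'a set \<Rightarrow> 'a set" where
  "argmin_set f F = {z. is_arg_min f (\<lambda>z. z \<in> F) z}"

definition original_feasible ::
  "(nat \<Rightarrow> drone_state \<Rightarrow> nat \<Rightarrow> real) \<Rightarrow> nat \<Rightarrow> nat \<Rightarrow> real \<Rightarrow> real \<Rightarrow> real \<Rightarrow> real \<Rightarrow>
     (real \<Rightarrow> real) \<Rightarrow> (real \<Rightarrow> real) \<Rightarrow> (real ^ 4) set \<Rightarrow>
     nat \<Rightarrow> (nat \<Rightarrow> drone_state) \<Rightarrow> (nat \<Rightarrow> real) \<Rightarrow> ((real ^ 4) \<times> real) set" where
  "original_feasible h n m \<delta> \<gamma> \<phi>min \<phi>max \<alpha>1 \<alpha>2 U i p \<psi> =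
     {(u, w). u \<in> U
        \<and> b_info_dot h n m \<delta> \<gamma> i p \<psi> u + \<alpha>1 (b_info h n m \<delta> \<gamma> i p \<psi>) \<ge> w
        \<and> b_gimbal_dot \<phi>min \<phi>max (p i) u + \<alpha>2 (b_gimbal \<phi>min \<phi>max (p i)) \<ge> 0}"

definition xi1 ::
  "(nat \<Rightarrow> drone_state \<Rightarrow> nat \<Rightarrow> real) \<Rightarrow> nat \<Rightarrow> nat \<Rightarrow> real \<Rightarrow>
     nat \<Rightarrow> (nat \<Rightarrow> drone_state) \<Rightarrow> (nat \<Rightarrow> real) \<Rightarrow> real ^ 4" where
  "xi1 h n m \<delta> i p \<psi> =
     (\<Sum>j \<in> cells h n m p i. (\<delta> * \<psi> j) *\<^sub>R gradient (\<lambda>x. h i x j) (p i))"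

definition xi2 ::
  "(nat \<Rightarrow> drone_state \<Rightarrow> nat \<Rightarrow> real) \<Rightarrow> nat \<Rightarrow> nat \<Rightarrow> real \<Rightarrow> real \<Rightarrow> real \<Rightarrow>
     nat \<Rightarrow> (nat \<Rightarrow> drone_state) \<Rightarrow> (nat \<Rightarrow> real) \<Rightarrow> real" where
  "xi2 h n m \<delta> \<gamma> a1 i p \<psi> =
     - (a1 * \<gamma> / real n)
     + (\<Sum>j \<in> cells h n m p i. (- \<delta>\<^sup>2 * (h i (p i) j)\<^sup>2 + a1 * \<delta> * h i (p i) j) * \<psi> j)"

text \<open>
  The last component of \<open>chi1\<close> carries a minus sign, as it must for \<open>chi1\<close> to be the gradient of
  \<^const>\<open>b_gimbal\<close>; the source omits this sign.
\<close>

definition chi1 :: "real \<Rightarrow> real \<Rightarrow> drone_state \<Rightarrow> real ^ 4" where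
  "chi1 \<phi>min \<phi>max x = vector [0, 0, 0, - 2 * (x $ 4 - (\<phi>min + \<phi>max) / 2)]"

definition chi2 :: "real \<Rightarrow> real \<Rightarrow> real \<Rightarrow> drone_state \<Rightarrow> real" where
  "chi2 \<phi>min \<phi>max a2 x = a2 * ((\<phi>max - \<phi>min)\<^sup>2 - (x $ 4 - (\<phi>min + \<phi>max) / 2)\<^sup>2)"

definition reformulated_feasible ::
  "(nat \<Rightarrow> drone_state \<Rightarrow> nat \<Rightarrow> real) \<Rightarrow> nat \<Rightarrow> nat \<Rightarrow> real \<Rightarrow> real \<Rightarrow> real \<Rightarrow> real \<Rightarrow>
     real \<Rightarrow> real \<Rightarrow> (real ^ 4) set \<Rightarrow>
     nat \<Rightarrow> (nat \<Rightarrow> drone_state) \<Rightarrow> (nat \<Rightarrow> real) \<Rightarrow> ((real ^ 4) \<times> real) set" where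
  "reformulated_feasible h n m \<delta> \<gamma> \<phi>min \<phi>max a1 a2 U i p \<psi> =
     {(u, w). u \<in> U
        \<and> xi1 h n m \<delta> i p \<psi> \<bullet> u + xi2 h n m \<delta> \<gamma> a1 i p \<psi> \<ge> w
        \<and> chi1 \<phi>min \<phi>max (p i) \<bullet> u + chi2 \<phi>min \<phi>max a2 (p i) \<ge> 0}"

end

theory Submission
  imports Defs
begin

text \<open>
  The two feasible sets are described by pairs of inequalities that turn out to be identical, so
  the minimisers coincide whatever the cost is.  For the gimbal constraint this is the gradient of
  a quadratic polynomial.  For the information constraint, the difficulty is that \<^const>\<open>b_info\<close> is
  a sum over the index set \<^const>\<open>cells\<close>, which moves with the state of the drone and makes the sum
  discontinuous in general.

  The absence of boundary points removes the difficulty.  At the given configuration, each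
  observation point is either seen by drone \<open>i\<close> strictly better than by every other drone, or seen
  strictly better by some other drone.  Both are strict inequalities between a function that is
  continuous at \<open>p i\<close> and a constant, so they persist for states near \<open>p i\<close>: the index set is
  locally constant (\<open>eventually_cells_eq\<close>), and the gradient of the sum is the sum of the
  gradients (\<open>gradient_b_info\<close>).  Continuity is needed at every observation point, also at
  those outside the cell, where differentiability is not assumed; it is derived from the formula
  for the performance (\<open>isCont_performance\<close>).

  In the direction of the importance indices, \<^const>\<open>b_info\<close> is affine, and for \<open>j\<close> in the cell of
  drone \<open>i\<close> the maximum in the dynamics of \<open>\<psi> j\<close> is attained by drone \<open>i\<close> itself, by the definition
  of the cell; this produces the term \<open>- \<delta>\<^sup>2 * h\<^sup>2 * \<psi> j\<close> of \<^const>\<open>xi2\<close> (\<open>psi_part_b_info_dot\<close>).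
\<close>

section \<open>Gradients\<close>

lemma gradient_eqI:
  assumes "GDERIV f x :> D"
  shows "gradient f x = D"
  unfolding gradient_def
proof (rule the_equality)
  show "GDERIV f x :> D" by fact
next
  fix E assume "GDERIV f x :> E"
  then have "(\<lambda>v. v \<bullet> E) = (\<lambda>v. v \<bullet> D)"
    using assms unfolding gderiv_def by (rule has_derivative_unique)
  then have "(E - D) \<bullet> E = (E - D) \<bullet> D" by metis
  then have "(E - D) \<bullet> (E - D) = 0" by (simp add: inner_diff_right)
  then show "E = D" by simp
qed

text \<open>
  In finite dimension every linear functional is the inner product with a vector, namely the one
  whose coordinates are the values of the functional on the basis.
\<close>

lemma GDERIV_gradient:
  fixes f :: "'a :: euclidean_space \<Rightarrow> real"
  assumes "f differentiable at x"
  shows "GDERIV f x :> gradient f x"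
proof -
  obtain f' where f': "(f has_derivative f') (at x)"
    using assms by (auto simp: differentiable_def)
  interpret linear f' using f' by (rule has_derivative_linear)
  define D where "D = (\<Sum>b\<in>Basis. f' b *\<^sub>R b)"
  have "f' v = v \<bullet> D" for v
  proof -
    have "f' v = f' (\<Sum>b\<in>Basis. (v \<bullet> b) *\<^sub>R b)" by (simp add: euclidean_representation)
    also have "\<dots> = (\<Sum>b\<in>Basis. (v \<bullet> b) * f' b)" by (simp add: sum scale)
    also have "\<dots> = v \<bullet> D" by (simp add: D_def inner_sum_right mult.commute)
    finally show ?thesis .
  qed
  then have "f' = (\<lambda>v. v \<bullet> D)" by (rule ext)
  then have "GDERIV f x :> D" using f' by (simp add: gderiv_def)
  then show ?thesis using gradient_eqI by metis
qed

lemma GDERIV_transform_eventually: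
  assumes "GDERIV g x :> D" and "\<forall>\<^sub>F y in nhds x. f y = g y"
  shows "GDERIV f x :> D"
proof -
  have "\<forall>\<^sub>F y in at x. g y = f y"
    using assms(2) by (auto simp: eventually_at_filter elim: eventually_mono)
  moreover have "g x = f x"
    using eventually_nhds_x_imp_x[OF assms(2)] by simp
  ultimately show ?thesis
    using assms(1) has_derivative_transform_eventually[of g _ x UNIV f]
    by (simp add: gderiv_def)
qed

lemma GDERIV_sum_cmult:
  assumes "\<And>j. j \<in> A \<Longrightarrow> GDERIV (f j) x :> D j"
  shows "GDERIV (\<lambda>x. \<Sum>j\<in>A. c j * f j x) x :> (\<Sum>j\<in>A. c j *\<^sub>R D j)"
  using assms unfolding gderiv_def inner_sum_right inner_scaleR_right
  by (intro has_derivative_sum has_derivative_mult_right) auto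

lemma gradient_b_gimbal: "gradient (b_gimbal \<phi>min \<phi>max) x = chi1 \<phi>min \<phi>max x"
proof (rule gradient_eqI)
  have comp: "((\<lambda>x :: drone_state. x $ 4) has_derivative (\<lambda>v. v $ 4)) (at x)"
    by (rule bounded_linear.has_derivative[OF bounded_linear_vec_nth has_derivative_ident])
  have inner: "v \<bullet> chi1 \<phi>min \<phi>max x = v $ 4 * (- 2 * (x $ 4 - (\<phi>min + \<phi>max) / 2))"
    for v :: "real ^ 4"
    by (simp add: inner_vec_def sum_4 chi1_def vector_def)
  show "GDERIV (b_gimbal \<phi>min \<phi>max) x :> chi1 \<phi>min \<phi>max x"
    unfolding gderiv_def inner b_gimbal_def[abs_def] power2_eq_square
    by (auto intro!: derivative_eq_intros comp simp: field_simps)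
qed

section \<open>Continuity of the performance function\<close>

lemma norm_spherical:
  "norm (vector [cos a * cos b, sin a * cos b, sin b] :: real ^ 3) = 1"
proof -
  have "(cos a * cos b)\<^sup>2 + (sin a * cos b)\<^sup>2 + (sin b)\<^sup>2
        = ((cos a)\<^sup>2 + (sin a)\<^sup>2) * (cos b)\<^sup>2 + (sin b)\<^sup>2"
    by (simp only: power_mult_distrib distrib_right)
  also have "\<dots> = 1" by (simp add: cos_squared_eq)
  finally show ?thesis by (simp add: norm_vec_def L2_set_def sum_3)
qed

lemma tendsto_vector_3:
  assumes "(f \<longlongrightarrow> a) F" "(g \<longlongrightarrow> b) F" "(k \<longlongrightarrow> c) F"
  shows "((\<lambda>x. vector [f x, g x, k x] :: real ^ 3) \<longlongrightarrow> vector [a, b, c]) F"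
proof (rule vec_tendstoI)
  fix l :: 3
  show "((\<lambda>x. (vector [f x, g x, k x] :: real ^ 3) $ l) \<longlongrightarrow> (vector [a, b, c] :: real ^ 3) $ l) F"
    using exhaust_3[of l] assms by auto
qed

text \<open>
  The real \<^const>\<open>arccos\<close> is continuous relative to \<open>{-1..1}\<close> only.  By the Cauchy-Schwarz
  inequality the cosine of an angle never leaves this interval (when \<open>v x = 0\<close> the quotient has the
  value \<open>0\<close>), so the angle is a continuous function even where the vectors are parallel and it may
  fail to be differentiable.
\<close>

lemma tendsto_arccos_angle:
  fixes u v :: "'b \<Rightarrow> 'a :: real_inner"
  assumes "(u \<longlongrightarrow> u0) F" "(v \<longlongrightarrow> v0) F" "v0 \<noteq> 0"
    and unit: "\<And>x. norm (u x) = 1" "norm u0 = 1"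
  shows "((\<lambda>x. arccos (u x \<bullet> v x / norm (v x))) \<longlongrightarrow> arccos (u0 \<bullet> v0 / norm v0)) F"
proof -
  have bound: "a \<bullet> b / norm b \<in> {-1..1}" if "norm a = 1" for a b :: 'a
  proof (cases "b = 0")
    case False
    then have "\<bar>a \<bullet> b / norm b\<bar> \<le> 1"
      using Cauchy_Schwarz_ineq2[of a b] that by (simp add: abs_divide divide_le_eq_1)
    then show ?thesis unfolding atLeastAtMost_iff by linarith
  qed simp
  have "((\<lambda>x. u x \<bullet> v x / norm (v x)) \<longlongrightarrow> u0 \<bullet> v0 / norm v0) F"
    using assms by (intro tendsto_intros) auto
  then show ?thesis
    by (rule continuous_on_tendsto_compose[OF continuous_on_arccos'])
      (use bound unit in auto)
qed

lemma isCont_performance: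
  assumes R: "isCont R x" "orthogonal_matrix (R x)"
    and nz: "view_world zc x q \<noteq> 0"
  shows "isCont (\<lambda>x. performance fov \<sigma>1 \<sigma>2 zc R x q) x"
proof -
  have world: "((\<lambda>y. view_world zc y q) \<longlongrightarrow> view_world zc x q) (at x)"
    unfolding view_world_def by (intro tendsto_vector_3 tendsto_intros)
  have axis: "(optical_axis \<longlongrightarrow> optical_axis x) (at x)"
    unfolding optical_axis_def by (intro tendsto_vector_3 tendsto_intros)
  have entry: "((\<lambda>y. R y $ k $ l) \<longlongrightarrow> R x $ k $ l) (at x)" for k l
    using R(1) unfolding isCont_def by (intro tendsto_vec_nth)
  have body: "((\<lambda>y. view_body (R y) zc y q) \<longlongrightarrow> view_body (R x) zc x q) (at x)"
    unfolding view_body_def matrix_vector_mult_def transpose_def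
    by (rule tendsto_vec_lambda) (simp, intro tendsto_intros entry world)
  have "orthogonal_transformation ((*v) (transpose (R x)))"
    using R(2) by (simp add: orthogonal_transformation_matrix matrix_vector_mul_linear)
  then have body_nz: "view_body (R x) zc x q \<noteq> 0"
    using nz orthogonal_transformation_norm[of "(*v) (transpose (R x))" "view_world zc x q"]
    unfolding view_body_def by (metis norm_eq_zero)
  have axis_unit: "norm (optical_axis y) = 1" for y
    unfolding optical_axis_def by (rule norm_spherical)
  have dir_unit: "norm (view_angle_vec q) = 1"
    unfolding view_angle_vec_def by (rule norm_spherical)
  have a1: "((\<lambda>y. arccos (optical_axis y \<bullet> view_body (R y) zc y q / norm (view_body (R y) zc y q)))
      \<longlongrightarrow> arccos (optical_axis x \<bullet> view_body (R x) zc x q / norm (view_body (R x) zc x q))) (at x)"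
    by (rule tendsto_arccos_angle[OF axis body body_nz axis_unit axis_unit])
  have a2: "((\<lambda>y. arccos (view_angle_vec q \<bullet> view_world zc y q / norm (view_world zc y q)))
      \<longlongrightarrow> arccos (view_angle_vec q \<bullet> view_world zc x q / norm (view_world zc x q))) (at x)"
    by (rule tendsto_arccos_angle[OF tendsto_const world nz dir_unit dir_unit])
  \<comment> \<open>The exponents are constant multiples of the squared angles.\<close>
  show ?thesis
    unfolding isCont_def performance_def h1_def h2_def divide_inverse[of _ "2 * _"]
    by (intro tendsto_mult tendsto_exp tendsto_minus tendsto_power tendsto_diff tendsto_const a1 a2)
qed

section \<open>The partition is locally constant away from its boundary\<close>

lemma finite_cells [simp]: "finite (cells h n m p i)"
  by (simp add: cells_def)

text \<open>
  Only drone \<open>i\<close> moves, so each comparison with another drone is between a function continuous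
  at \<open>p i\<close> and a constant.  Membership is decided by strict comparisons: for \<open>j\<close> in the cell all
  of them are strict, as \<open>j\<close> is off the boundary, and for \<open>j\<close> outside some competitor wins strictly.
  Finitely many strict inequalities persist together in a neighbourhood.
\<close>

lemma eventually_cells_eq:
  assumes i: "i \<in> {1..n}"
    and cont: "\<And>j. j \<in> {1..m} \<Longrightarrow> isCont (\<lambda>x. h i x j) (p i)"
    and no_boundary: "\<forall>j\<in>{1..m}. \<not> on_cell_boundary h n m p i j"
  shows "\<forall>\<^sub>F x in nhds (p i). cells h n m (p(i := x)) i = cells h n m p i"
proof -
  have lim: "((\<lambda>x. h i x j) \<longlongrightarrow> h i (p i) j) (nhds (p i))" if "j \<in> {1..m}" for j
    using cont[OF that] tendsto_at_iff_tendsto_nhds[of "\<lambda>x. h i x j" "p i"]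
    by (simp add: isCont_def)
  have "\<forall>\<^sub>F x in nhds (p i). j \<in> cells h n m (p(i := x)) i \<longleftrightarrow> j \<in> cells h n m p i"
    if j: "j \<in> {1..m}" for j
  proof (cases "j \<in> cells h n m p i")
    case True
    have "\<forall>\<^sub>F x in nhds (p i). h k (p k) j < h i x j" if k: "k \<in> {1..n} - {i}" for k
    proof (rule order_tendstoD(1)[OF lim[OF j]])
      have "h k (p k) j \<le> h i (p i) j" using True k by (simp add: cells_def)
      moreover have "h k (p k) j \<noteq> h i (p i) j"
        using True k j no_boundary by (metis DiffE insertI1 on_cell_boundary_def)
      ultimately show "h k (p k) j < h i (p i) j" by simp
    qed
    then have "\<forall>\<^sub>F x in nhds (p i). \<forall>k\<in>{1..n} - {i}. h k (p k) j < h i x j"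
      by (intro eventually_ball_finite) auto
    then show ?thesis
      by (rule eventually_mono) (use True j in \<open>auto simp: cells_def less_imp_le\<close>)
  next
    case False
    then obtain k where k: "k \<in> {1..n}" and less: "h i (p i) j < h k (p k) j"
      using j by (auto simp: cells_def not_le)
    then have "k \<noteq> i" by auto
    show ?thesis
      using order_tendstoD(2)[OF lim[OF j] less]
      by (rule eventually_mono) (use False k \<open>k \<noteq> i\<close> in \<open>auto simp: cells_def\<close>)
  qed
  then have "\<forall>\<^sub>F x in nhds (p i). \<forall>j\<in>{1..m}.
      j \<in> cells h n m (p(i := x)) i \<longleftrightarrow> j \<in> cells h n m p i"
    by (intro eventually_ball_finite) auto
  moreover have "cells h n m p' i \<subseteq> {1..m}" for p'
    by (auto simp: cells_def)
  ultimately show ?thesis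
    by (elim eventually_mono) blast
qed

section \<open>The derivative of the information barrier\<close>

lemma gradient_b_info:
  assumes i: "i \<in> {1..n}"
    and cont: "\<And>j. j \<in> {1..m} \<Longrightarrow> isCont (\<lambda>x. h i x j) (p i)"
    and diff: "\<forall>j\<in>cells h n m p i. (\<lambda>x. h i x j) differentiable at (p i)"
    and no_boundary: "\<forall>j\<in>{1..m}. \<not> on_cell_boundary h n m p i j"
  shows "gradient (\<lambda>x. b_info h n m \<delta> \<gamma> i (p(i := x)) \<psi>) (p i) = xi1 h n m \<delta> i p \<psi>"
proof (rule gradient_eqI, rule GDERIV_transform_eventually)
  let ?V = "cells h n m p i"
  have "GDERIV (\<lambda>x. \<Sum>j\<in>?V. (\<delta> * \<psi> j) * h i x j) (p i) :> xi1 h n m \<delta> i p \<psi>"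
    unfolding xi1_def by (rule GDERIV_sum_cmult) (use diff in \<open>auto intro: GDERIV_gradient\<close>)
  from GDERIV_diff[OF this GDERIV_const[of "\<gamma> / real n"]]
  show "GDERIV (\<lambda>x. (\<Sum>j\<in>?V. (\<delta> * \<psi> j) * h i x j) - \<gamma> / real n) (p i) :> xi1 h n m \<delta> i p \<psi>"
    by simp
  show "\<forall>\<^sub>F x in nhds (p i). b_info h n m \<delta> \<gamma> i (p(i := x)) \<psi>
          = (\<Sum>j\<in>?V. (\<delta> * \<psi> j) * h i x j) - \<gamma> / real n"
    using eventually_cells_eq[OF i cont no_boundary]
    by (rule eventually_mono) (auto simp: b_info_def ac_simps)
qed

lemma deriv_b_info_psi:
  "deriv (\<lambda>s. b_info h n m \<delta> \<gamma> i p (\<psi>(j := s))) (\<psi> j)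
     = (if j \<in> cells h n m p i then \<delta> * h i (p i) j else 0)"
proof (rule DERIV_imp_deriv)
  let ?V = "cells h n m p i"
  let ?c = "(\<Sum>l\<in>?V - {j}. \<delta> * h i (p i) l * \<psi> l) - \<gamma> / real n"
  have affine: "b_info h n m \<delta> \<gamma> i p (\<psi>(j := s))
      = (if j \<in> ?V then \<delta> * h i (p i) j else 0) * s + ?c" for s
  proof (cases "j \<in> ?V")
    case True
    then show ?thesis by (simp add: b_info_def sum.remove[of ?V j])
  next
    case False
    then have "(\<Sum>l\<in>?V. \<delta> * h i (p i) l * (\<psi>(j := s)) l) = (\<Sum>l\<in>?V. \<delta> * h i (p i) l * \<psi> l)"
      by (intro sum.cong) auto
    with False show ?thesis by (simp add: b_info_def)
  qed
  show "((\<lambda>s. b_info h n m \<delta> \<gamma> i p (\<psi>(j := s))) has_real_derivative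
      (if j \<in> ?V then \<delta> * h i (p i) j else 0)) (at (\<psi> j))"
    unfolding affine by (auto intro!: derivative_eq_intros)
qed

lemma psi_dot_in_cell:
  assumes "i \<in> {1..n}" "j \<in> cells h n m p i"
  shows "psi_dot h n \<delta> p \<psi> j = - \<delta> * h i (p i) j * \<psi> j"
proof -
  have "Max ((\<lambda>k. h k (p k) j) ` {1..n}) = h i (p i) j"
    using assms by (intro Max_eqI) (auto simp: cells_def)
  then show ?thesis by (simp add: psi_dot_def)
qed

text \<open>
  The sum over all observation points collapses to the cell, because \<^const>\<open>b_info\<close> is
  independent of the importance of the points outside.
\<close>

lemma psi_part_b_info_dot:
  assumes "i \<in> {1..n}"
  shows "(\<Sum>j\<in>{1..m}. deriv (\<lambda>s. b_info h n m \<delta> \<gamma> i p (\<psi>(j := s))) (\<psi> j) * psi_dot h n \<delta> p \<psi> j)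
       = (\<Sum>j\<in>cells h n m p i. - \<delta>\<^sup>2 * (h i (p i) j)\<^sup>2 * \<psi> j)"
proof (rule sum.mono_neutral_cong_right)
  show "cells h n m p i \<subseteq> {1..m}" by (auto simp: cells_def)
qed (use assms in \<open>auto simp: deriv_b_info_psi psi_dot_in_cell power2_eq_square\<close>)

lemma b_info_constraint_eq:
  assumes "i \<in> {1..n}"
    and "\<And>j. j \<in> {1..m} \<Longrightarrow> isCont (\<lambda>x. h i x j) (p i)"
    and "\<forall>j\<in>cells h n m p i. (\<lambda>x. h i x j) differentiable at (p i)"
    and "\<forall>j\<in>{1..m}. \<not> on_cell_boundary h n m p i j"
  shows "b_info_dot h n m \<delta> \<gamma> i p \<psi> u + a * b_info h n m \<delta> \<gamma> i p \<psi>
       = xi1 h n m \<delta> i p \<psi> \<bullet> u + xi2 h n m \<delta> \<gamma> a i p \<psi>"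
proof -
  have "gradient (\<lambda>x. b_info h n m \<delta> \<gamma> i (p(i := x)) \<psi>) (p i) = xi1 h n m \<delta> i p \<psi>"
    using assms by (rule gradient_b_info)
  then show ?thesis
    unfolding b_info_dot_def psi_part_b_info_dot[OF assms(1)]
    by (simp only:) (simp add: xi2_def b_info_def algebra_simps sum.distrib sum_distrib_left
      sum_subtractf sum_negf)
qed

section \<open>Equivalence of the optimisation problems\<close>

theorem theorem3p1:
  fixes n m i :: nat
    and P :: "(real ^ 2) set" and Q :: "obs_point set" and U :: "(real ^ 4) set"
    and R :: "nat \<Rightarrow> drone_state \<Rightarrow> real ^ 3 ^ 3"
    and p :: "nat \<Rightarrow> drone_state" and q :: "nat \<Rightarrow> obs_point" and \<psi> :: "nat \<Rightarrow> real"
    and zc fov \<sigma>1 \<sigma>2 \<delta> \<gamma> \<phi>min \<phi>max \<epsilon> a1 a2 :: real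
    and \<alpha>1 \<alpha>2 :: "real \<Rightarrow> real"
    and h :: "nat \<Rightarrow> drone_state \<Rightarrow> nat \<Rightarrow> real"
  assumes i: "i \<in> {1..n}"
    and P: "compact P"
    and p: "\<forall>k \<in> {1..n}. vector [p k $ 1, p k $ 2] \<in> P
              \<and> p k $ 3 \<in> {0..<2 * pi} \<and> p k $ 4 \<in> {0..pi / 2}"
    and R: "\<forall>k \<in> {1..n}. \<forall>x. rotation_matrix (R k x)"
    and Q: "\<forall>y \<in> Q. y $ 4 \<in> {- pi..<pi} \<and> y $ 5 \<in> {0<..pi / 2}"
    and q: "\<forall>j \<in> {1..m}. q j \<in> Q"
    and \<sigma>: "\<sigma>1 \<noteq> 0" "\<sigma>2 \<noteq> 0"
    and h: "h = (\<lambda>k x j. performance fov \<sigma>1 \<sigma>2 zc (R k) x (q j))"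
    and \<psi>: "\<forall>j \<in> {1..m}. \<psi> j \<ge> 0"
    and pos: "\<delta> > 0" "\<gamma> > 0"
    and view_nonzero: "\<forall>k \<in> {1..n}. \<forall>j \<in> {1..m}. view_world zc (p k) (q j) \<noteq> 0"
    and R_cont: "isCont (R i) (p i)"
    and h_diff: "\<forall>j \<in> cells h n m p i. (\<lambda>x. h i x j) differentiable at (p i)"
    and no_boundary: "\<forall>j \<in> {1..m}. \<not> on_cell_boundary h n m p i j"
    and a: "a1 > 0" "a2 > 0"
    and \<alpha>1: "\<forall>s. \<alpha>1 s = a1 * s"
    and \<alpha>2: "\<forall>s. \<alpha>2 s = a2 * s"
  shows "original_feasible h n m \<delta> \<gamma> \<phi>min \<phi>max \<alpha>1 \<alpha>2 U i p \<psi>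
           = reformulated_feasible h n m \<delta> \<gamma> \<phi>min \<phi>max a1 a2 U i p \<psi>
         \<and> argmin_set (cost \<epsilon>) (original_feasible h n m \<delta> \<gamma> \<phi>min \<phi>max \<alpha>1 \<alpha>2 U i p \<psi>)
           = argmin_set (cost \<epsilon>) (reformulated_feasible h n m \<delta> \<gamma> \<phi>min \<phi>max a1 a2 U i p \<psi>)"
proof -
  have cont: "isCont (\<lambda>x. h i x j) (p i)" if "j \<in> {1..m}" for j
    unfolding h using R_cont R view_nonzero i that
    by (intro isCont_performance) (auto simp: rotation_matrix_def)
  have info: "b_info_dot h n m \<delta> \<gamma> i p \<psi> u + \<alpha>1 (b_info h n m \<delta> \<gamma> i p \<psi>)
      = xi1 h n m \<delta> i p \<psi> \<bullet> u + xi2 h n m \<delta> \<gamma> a1 i p \<psi>" for u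
    using b_info_constraint_eq[where h = h and i = i and p = p, OF i cont h_diff no_boundary] \<alpha>1 by simp
  have gimbal: "b_gimbal_dot \<phi>min \<phi>max (p i) u + \<alpha>2 (b_gimbal \<phi>min \<phi>max (p i))
      = chi1 \<phi>min \<phi>max (p i) \<bullet> u + chi2 \<phi>min \<phi>max a2 (p i)" for u
    using \<alpha>2 by (simp add: b_gimbal_dot_def gradient_b_gimbal chi2_def b_gimbal_def)
  have "original_feasible h n m \<delta> \<gamma> \<phi>min \<phi>max \<alpha>1 \<alpha>2 U i p \<psi>
      = reformulated_feasible h n m \<delta> \<gamma> \<phi>min \<phi>max a1 a2 U i p \<psi>"
    unfolding original_feasible_def reformulated_feasible_def info gimbal ..
  then show ?thesis by simp
qed

end
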